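(* Let $X=(x_{ij})$ be an $n\times n$ matrix of indeterminates over $\mathbb{Z}$, with $n\geqslant3$. Fix a prime $p>0$, let $\varphi_p$ be the standard $p$-derivation on $S=\mathbb{Z}[X]$ with respect to the entries of $X$, set $R=S/(\det X)$, and let $\mathfrak{a}=(x_{12},\dots,x_{1n},x_{22},\dots,x_{2n})R$. Then \[ \left[\frac{\varphi_p(\det X)}{(x_{12}\cdots x_{1n}x_{22}\cdots x_{2n})^p}\right]\in H^{2n-2}_{\mathfrak{a}}(R) \] is a nonzero $p$-torsion element, and its image in $H^{2n-2}_{\mathfrak{a}}(R/pR)$ is nonzero. In particular, $H^{2n-2}_{\mathfrak{a}}(R)$ contains a nonzero $p$-torsion element for each prime $p>0$.
   Context: For a polynomial ring $S=\mathbb{Z}[\boldsymbol{x}]$, the standard lift of Frobenius $\Lambda_p$ is the ring endomorphism with $\Lambda_p(x)=x^p$ for each indeterminate $x$, and the standard $p$-derivation is $\varphi_p(s)=(\Lambda_p(s)-s^p)/p$. The local cohomology class is the Čech class (on the $2n-2$ listed generators of $\mathfrak{a}$) of the image of $\varphi_p(\det X)$ in $R$. *)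

theory Defs
  imports "HOL-Computational_Algebra.Primes" "HOL-Library.Poly_Mapping" "HOL-Combinatorics.Permutations"
begin

text \<open>The polynomial ring S = Z[x_ij : i,j < n] (0-indexed), as finitely supported
  maps from monomials (exponent vectors) to integer coefficients.\<close>
type_synonym mono = "(nat \<times> nat) \<Rightarrow>\<^sub>0 nat"
type_synonym zpoly = "mono \<Rightarrow>\<^sub>0 int"

definition var :: "nat \<Rightarrow> nat \<Rightarrow> zpoly" where
  "var i j = Poly_Mapping.single (Poly_Mapping.single (i, j) 1) 1"

definition const :: "int \<Rightarrow> zpoly" where
  "const c = Poly_Mapping.single 0 c"

definition detX :: "nat \<Rightarrow> zpoly" where
  "detX n = (\<Sum>\<sigma>\<in>{\<sigma>. \<sigma> permutes {0..<n}}.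
               const (sign \<sigma>) * (\<Prod>i\<in>{0..<n}. var i (\<sigma> i)))"

text \<open>Standard lift of Frobenius: the ring endomorphism with x \<mapsto> x^p.\<close>
definition Lambda :: "nat \<Rightarrow> zpoly \<Rightarrow> zpoly" where
  "Lambda p s = (\<Sum>m\<in>Poly_Mapping.keys s. Poly_Mapping.single (Poly_Mapping.map (\<lambda>e. p * e) m) (Poly_Mapping.lookup s m))"

text \<open>Standard p-derivation phi_p(s) = (Lambda_p(s) - s^p)/p
  (the division is exact; it is performed coefficientwise).\<close>
definition pder :: "nat \<Rightarrow> zpoly \<Rightarrow> zpoly" where
  "pder p s = Poly_Mapping.map (\<lambda>c. c div int p) (Lambda p s - s ^ p)"

definition zero_in_R :: "nat \<Rightarrow> zpoly \<Rightarrow> bool" where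
  "zero_in_R n a \<longleftrightarrow> (\<exists>b. a = b * detX n)"

definition zero_in_R_mod :: "nat \<Rightarrow> nat \<Rightarrow> zpoly \<Rightarrow> bool" where
  "zero_in_R_mod n p a \<longleftrightarrow> (\<exists>b c. a = b * detX n + c * const (int p))"

text \<open>Top Cech cohomology H^k_a(A) for generators f_g (g \<in> G, k = card G) of a ring A,
  which is the cokernel of the map (+)_g A_{f/f_g} \<rightarrow> A_f, f = prod f_g.
  Here A is a quotient of S whose zero test is Z.  The class [r / f^t] vanishes iff
  r/f^t equals, in A_f, the image of a tuple (s_g / (f/f_g)^m)_g, i.e. (sum s_g f_g^m)/f^m;
  by definition of localization this means f^N (r f^m - f^t sum s_g f_g^m) = 0 in A.\<close>
definition cech_top_class_zero ::
  "(zpoly \<Rightarrow> bool) \<Rightarrow> (nat \<times> nat) set \<Rightarrow> (nat \<times> nat \<Rightarrow> zpoly) \<Rightarrow> zpoly \<Rightarrow> nat \<Rightarrow> bool" where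
  "cech_top_class_zero Z G f r t \<longleftrightarrow>
     (\<exists>m N (s :: nat \<times> nat \<Rightarrow> zpoly).
        Z ((\<Prod>g\<in>G. f g) ^ N *
           (r * (\<Prod>g\<in>G. f g) ^ m - (\<Prod>g\<in>G. f g) ^ t * (\<Sum>g\<in>G. s g * f g ^ m))))"

text \<open>The generators x_12..x_1n, x_22..x_2n (1-indexed) = rows 0,1 and columns 1..n-1.\<close>
definition gens :: "nat \<Rightarrow> (nat \<times> nat) set" where
  "gens n = {(i, j). i < 2 \<and> 1 \<le> j \<and> j < n}"

definition gvar :: "nat \<times> nat \<Rightarrow> zpoly" where
  "gvar g = var (fst g) (snd g)"

end

theory Submission
  imports Defs
begin

text \<open>
  Write \<open>d = det X\<close>, let \<open>f\<close> be the product of the \<open>2n - 2\<close> generators, and let \<open>\<phi>\<close> be the standard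
  \<open>p\<close>-derivation. Since \<open>p \<phi>(d) = \<Lambda>(d) - d ^ p\<close> and every term of \<open>\<Lambda>(d)\<close> is divisible by the \<open>p\<close>-th power
  of a generator, the class is killed by \<open>p\<close>.

  For the nonvanishing modulo \<open>p\<close>, it suffices to show \<open>f ^ M \<phi>(d) \<notin> (p, d, g ^ (M + p) : g)\<close> for all \<open>M\<close>,
  where \<open>g\<close> runs over the generators. This is done with a \<open>\<int>\<close>-linear functional \<open>\<psi>\<close> on \<open>S\<close> that vanishes on the multiples
  of \<open>g ^ (M + p)\<close> and takes values divisible by \<open>p\<close> on the multiples of \<open>d\<close>. It factors through setting
  \<open>x\<^sub>3\<^sub>1 = 0\<close> and making the rows from the fourth on those of the identity matrix, which turns \<open>d\<close> into \<open>t L - s K\<close>, where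
  \<open>L = u c - v a\<close>, \<open>K = u e - v b\<close>, the first two rows of the upper left corner are \<open>(u, a, b)\<close>, \<open>(v, c, e)\<close>, and its third
  row is \<open>(0, s, t)\<close>. If \<open>F\<^sub>i\<close> is the coefficient of \<open>t ^ i s ^ (p - i)\<close> in \<open>F\<close>, then the sum of the
  \<open>K ^ (i - 1) L ^ (p - i) F\<^sub>i\<close> over \<open>1 \<le> i \<le> p\<close> telescopes, for \<open>F = d G\<close>, to \<open>L ^ p G\<^sub>0\<close> with
  \<open>G\<^sub>0\<close> the coefficient of \<open>s ^ (p - 1)\<close>. Modulo \<open>p\<close> this is \<open>((u c) ^ p - (v a) ^ p) G\<^sub>0\<close>, and \<open>\<psi>\<close> extracts the
  coefficient of \<open>u ^ p v ^ (p - 1) c ^ (M + 1) (a e) ^ (M + p - 1) b ^ M\<close>, to which \<open>(v a) ^ p\<close> does not contribute, while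
  the contribution of \<open>(u c) ^ p\<close> is cancelled by a correction read off from \<open>F\<^sub>0\<close>.
  Over the integers, \<open>p \<psi>(f ^ M \<phi>(d)) = - \<psi>(d f ^ M d ^ (p - 1))\<close>
  sees only the monomial \<open>(u e s) ^ (p - 1)\<close> of \<open>d ^ (p - 1)\<close> and equals \<open>\<plusminus>p\<close>, so \<open>\<psi>(f ^ M \<phi>(d)) = \<plusminus>1\<close>.
\<close>

section \<open>Linear functionals on polynomials\<close>

text \<open>Values are integers rather than residues because a factor \<open>p\<close> is cancelled
  later.\<close>

definition lin :: "('a \<Rightarrow> int) \<Rightarrow> ('a \<Rightarrow>\<^sub>0 int) \<Rightarrow> int" where
  "lin h F = (\<Sum>m\<in>Poly_Mapping.keys F. Poly_Mapping.lookup F m * h m)"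

lemma lin_zero [simp]: "lin h 0 = 0"
  by (simp add: lin_def)

lemma lin_single [simp]: "lin h (Poly_Mapping.single m c) = c * h m"
  by (simp add: lin_def)

lemma lin_add: "lin h (F + G) = lin h F + lin h G"
  unfolding lin_def by (rule setsum_keys_plus_distrib) (simp_all add: algebra_simps)

lemma lin_uminus: "lin h (- F) = - lin h F"
  by (simp add: lin_def sum_negf)

lemma lin_diff: "lin h (F - G) = lin h F - lin h G"
  using lin_add[of h F "- G"] by (simp add: lin_uminus)

lemma lin_sum: "lin h (\<Sum>i\<in>I. F i) = (\<Sum>i\<in>I. lin h (F i))"
  by (induction I rule: infinite_finite_induct) (simp_all add: lin_add)

lemma poly_mapping_eq_sum_single:
  "(F :: 'a \<Rightarrow>\<^sub>0 'b::comm_monoid_add) =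
     (\<Sum>m\<in>Poly_Mapping.keys F. Poly_Mapping.single m (Poly_Mapping.lookup F m))"
  by (rule poly_mapping_eqI)
     (auto simp: lookup_sum lookup_single when_def in_keys_iff)

lemma lin_mult_single:
  fixes F :: "'a::comm_monoid_add \<Rightarrow>\<^sub>0 int"
  shows "lin h (F * Poly_Mapping.single k c) = c * lin (\<lambda>m. h (m + k)) F"
proof -
  have "lin h (F * Poly_Mapping.single k c) =
      lin h ((\<Sum>m\<in>Poly_Mapping.keys F. Poly_Mapping.single m (Poly_Mapping.lookup F m)) * Poly_Mapping.single k c)"
    using poly_mapping_eq_sum_single[of F] by simp
  also have "\<dots> = c * lin (\<lambda>m. h (m + k)) F"
    by (simp add: sum_distrib_right lin_sum mult_single)
       (simp add: lin_def sum_distrib_left algebra_simps)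
  finally show ?thesis .
qed

lemma lin_dvd: "(\<And>m. d dvd h m) \<Longrightarrow> d dvd lin h F"
  unfolding lin_def by (intro dvd_sum) simp

lemma lin_eq_zero: "(\<And>m. h m = 0) \<Longrightarrow> lin h F = 0"
  by (simp add: lin_def)

lemma lin_concentrated:
  assumes "\<And>m. m \<noteq> k \<Longrightarrow> h m = 0"
  shows "lin h F = Poly_Mapping.lookup F k * h k"
proof -
  have "lin h F = (\<Sum>m\<in>Poly_Mapping.keys F. if m = k then Poly_Mapping.lookup F k * h k else 0)"
    unfolding lin_def by (rule sum.cong) (auto simp: assms)
  then show ?thesis by (auto simp: in_keys_iff)
qed

lemma lookup_map_mult [simp]:
  "Poly_Mapping.lookup (Poly_Mapping.map (\<lambda>e. k * e) m) x = k * (Poly_Mapping.lookup m x :: 'b::mult_zero)"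
  by (simp add: Poly_Mapping.map.rep_eq when_def)

lemma single_power:
  "Poly_Mapping.single (m :: 'a \<Rightarrow>\<^sub>0 nat) (c :: int) ^ k = Poly_Mapping.single (Poly_Mapping.map (\<lambda>e. k * e) m) (c ^ k)"
proof (induction k)
  case 0
  have "Poly_Mapping.map (\<lambda>e. 0 * e) m = 0" by (simp add: Poly_Mapping.map_eq_zero_iff)
  then show ?case by simp
next
  case (Suc k)
  have "m + Poly_Mapping.map (\<lambda>e. k * e) m = Poly_Mapping.map (\<lambda>e. Suc k * e) m"
    by (rule poly_mapping_eqI) (simp add: lookup_add del: mult_Suc, simp)
  then show ?case by (simp add: Suc mult_single del: mult_Suc)
qed

lemma prod_single_1:
  "(\<Prod>i\<in>I. Poly_Mapping.single (m i) (1::int)) = Poly_Mapping.single (\<Sum>i\<in>I. m i :: 'a::comm_monoid_add) 1"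
  by (induction I rule: infinite_finite_induct) (simp_all add: mult_single)

section \<open>Congruences modulo a prime\<close>

lemma prime_dvd_power_add:
  fixes x y :: "'a::comm_ring_1"
  assumes "prime p"
  shows "of_nat p dvd (x + y) ^ p - x ^ p - y ^ p"
proof -
  have p: "0 < p" "p \<noteq> 0" using assms prime_gt_0_nat by auto
  have "(x + y) ^ p = (\<Sum>k\<le>p. of_nat (p choose k) * x ^ k * y ^ (p - k))"
    by (rule binomial_ring)
  also have "{..p} = insert 0 (insert p {0<..<p})" using p by auto
  also have "(\<Sum>k\<in>\<dots>. of_nat (p choose k) * x ^ k * y ^ (p - k)) =
     y ^ p + x ^ p + (\<Sum>k\<in>{0<..<p}. of_nat (p choose k) * x ^ k * y ^ (p - k))"
    using p by (simp add: add.assoc)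
  finally have eq: "(x + y) ^ p - x ^ p - y ^ p = (\<Sum>k\<in>{0<..<p}. of_nat (p choose k) * x ^ k * y ^ (p - k))"
    by simp
  show ?thesis unfolding eq
  proof (rule dvd_sum)
    fix k assume "k \<in> {0<..<p}"
    then have "p dvd (p choose k)"
      using assms by (intro dvd_choose_prime) auto
    then have "(of_nat p :: 'a) dvd of_nat (p choose k)" by (auto elim!: dvdE)
    then show "of_nat p dvd of_nat (p choose k) * x ^ k * y ^ (p - k)" by simp
  qed
qed

lemma prime_dvd_power_sum:
  fixes f :: "'i \<Rightarrow> 'a::comm_ring_1"
  assumes "prime p"
  shows "of_nat p dvd (\<Sum>i\<in>I. f i) ^ p - (\<Sum>i\<in>I. f i ^ p)"
proof (induction I rule: infinite_finite_induct)
  case (insert i I)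
  have "(\<Sum>j\<in>insert i I. f j) ^ p - (\<Sum>j\<in>insert i I. f j ^ p) =
    ((f i + (\<Sum>j\<in>I. f j)) ^ p - f i ^ p - (\<Sum>j\<in>I. f j) ^ p) + ((\<Sum>j\<in>I. f j) ^ p - (\<Sum>j\<in>I. f j ^ p))"
    using insert by simp
  then show ?case
    using insert.IH prime_dvd_power_add[OF assms, of "f i" "\<Sum>j\<in>I. f j"] by (metis dvd_add)
qed (use prime_gt_0_nat[OF assms] in \<open>auto simp: zero_power\<close>)

section \<open>The determinant, its Frobenius lift and its powers\<close>

definition mon :: "nat \<Rightarrow> (nat \<Rightarrow> nat) \<Rightarrow> mono" where
  "mon n \<sigma> = (\<Sum>i<n. Poly_Mapping.single (i, \<sigma> i) 1)"

lemma lookup_mon: "Poly_Mapping.lookup (mon n \<sigma>) (i, j) = (if i < n \<and> \<sigma> i = j then 1 else 0)"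
proof -
  have "Poly_Mapping.lookup (mon n \<sigma>) (i, j) = (\<Sum>k<n. if k = i then (if \<sigma> i = j then 1 else 0) else 0)"
    unfolding mon_def lookup_sum by (rule sum.cong) (auto simp: lookup_single when_def)
  then show ?thesis by simp
qed

lemma detX_eq_sum_single:
  "detX n = (\<Sum>\<sigma> | \<sigma> permutes {0..<n}. Poly_Mapping.single (mon n \<sigma>) (sign \<sigma>))"
  unfolding detX_def
  by (rule sum.cong)
     (auto simp: var_def const_def prod_single_1 mult_single mon_def lessThan_atLeast0)

lemma const_int: "const (int k) = of_nat k"
  by (simp add: const_def)

lemma Lambda_add: "Lambda p (F + G) = Lambda p F + Lambda p G"
  unfolding Lambda_def by (rule setsum_keys_plus_distrib) (simp_all add: single_add)

lemma Lambda_sum: "Lambda p (\<Sum>i\<in>I. F i) = (\<Sum>i\<in>I. Lambda p (F i))"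
proof -
  have "Lambda p 0 = 0" by (simp add: Lambda_def)
  then show ?thesis
    by (induction I rule: infinite_finite_induct) (simp_all add: Lambda_add)
qed

lemma Lambda_single: "Lambda p (Poly_Mapping.single m c) = Poly_Mapping.single (Poly_Mapping.map (\<lambda>e. p * e) m) c"
  by (simp add: Lambda_def)

lemma Lambda_detX:
  "Lambda p (detX n) = (\<Sum>\<sigma> | \<sigma> permutes {0..<n}. const (sign \<sigma>) * Poly_Mapping.single (mon n \<sigma>) 1 ^ p)"
  by (simp add: detX_eq_sum_single Lambda_sum Lambda_single single_power const_def mult_single)

text \<open>\<open>Lambda\<close> keeps coefficients whereas a p-th power raises them; for signs
  this matters only when \<open>p = 2\<close>.\<close>

lemma prime_dvd_sign_power:
  assumes "prime p"
  shows "int p dvd sign \<sigma> - sign \<sigma> ^ p"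
proof (cases "odd p")
  case True then show ?thesis by (cases \<sigma> rule: sign_cases) simp_all
next
  case False
  then have "p = 2" using assms primes_dvd_imp_eq two_is_prime_nat by blast
  then show ?thesis by (cases \<sigma> rule: sign_cases) simp_all
qed

lemma dvd_diff_trans:
  fixes a b c d :: "'a::comm_ring_1"
  assumes "d dvd a - c" and "d dvd b - c"
  shows "d dvd a - b"
  using dvd_diff[OF assms] by simp

text \<open>Modulo \<open>p\<close> both terms on the right agree with the sum of the p-th powers of
  the signed monomials, so their difference is some \<open>p Q\<close>, and the coefficientwise
  \<open>div\<close> returns exactly \<open>Q\<close>.\<close>

lemma const_mult_pder_detX:
  assumes "prime p"
  shows "const (int p) * pder p (detX n) = Lambda p (detX n) - detX n ^ p"
proof -
  have "of_nat p dvd Lambda p (detX n) - (\<Sum>\<sigma> | \<sigma> permutes {0..<n}. Poly_Mapping.single (mon n \<sigma>) (sign \<sigma>) ^ p)"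
    unfolding Lambda_detX sum_subtractf[symmetric]
  proof (rule dvd_sum)
    fix \<sigma> assume "\<sigma> \<in> {\<sigma>. \<sigma> permutes {0..<n}}"
    obtain k where "sign \<sigma> - sign \<sigma> ^ p = int p * k"
      using prime_dvd_sign_power[OF assms] by (auto elim: dvdE)
    then have "const (sign \<sigma>) * Poly_Mapping.single (mon n \<sigma>) 1 ^ p - Poly_Mapping.single (mon n \<sigma>) (sign \<sigma>) ^ p
       = Poly_Mapping.single 0 (int p) * Poly_Mapping.single (Poly_Mapping.map (\<lambda>e. p * e) (mon n \<sigma>)) k"
      by (simp add: const_def single_power mult_single single_diff[symmetric] del: single_of_nat)
    then show "of_nat p dvd const (sign \<sigma>) * Poly_Mapping.single (mon n \<sigma>) 1 ^ p - Poly_Mapping.single (mon n \<sigma>) (sign \<sigma>) ^ p"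
      by simp
  qed
  moreover have "of_nat p dvd detX n ^ p - (\<Sum>\<sigma> | \<sigma> permutes {0..<n}. Poly_Mapping.single (mon n \<sigma>) (sign \<sigma>) ^ p)"
    unfolding detX_eq_sum_single by (rule prime_dvd_power_sum[OF assms])
  ultimately have "of_nat p dvd Lambda p (detX n) - detX n ^ p"
    by (rule dvd_diff_trans)
  then obtain Q where Q: "Lambda p (detX n) - detX n ^ p = const (int p) * Q"
    by (auto elim!: dvdE simp: const_int)
  have const_mult: "Poly_Mapping.lookup (const c * F) m = c * Poly_Mapping.lookup F m" for c F m
    by (simp add: const_def mult_map_scale_conv_mult[symmetric])
  have "pder p (detX n) = Q"
    unfolding pder_def Q
    by (rule poly_mapping_eqI)
       (use assms prime_gt_0_nat in \<open>auto simp: Poly_Mapping.map.rep_eq const_mult when_def\<close>)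
  then show ?thesis by (simp add: Q)
qed

lemma lookup_mult_single:
  fixes F :: "mono \<Rightarrow>\<^sub>0 int"
  shows "Poly_Mapping.lookup (F * Poly_Mapping.single k c) x
    = (\<Sum>m\<in>Poly_Mapping.keys F. if m + k = x then c * Poly_Mapping.lookup F m else 0)"
proof -
  have *: "Poly_Mapping.lookup G x = lin (\<lambda>m. if m = x then 1 else 0) G" for G :: "mono \<Rightarrow>\<^sub>0 int"
    by (subst lin_concentrated[of x]) auto
  show ?thesis unfolding * lin_mult_single unfolding lin_def sum_distrib_left
    by (rule sum.cong) auto
qed

text \<open>A product of \<open>k\<close> terms reaches this monomial only if each is the term of
  \<open>\<sigma>\<close>: a factor \<open>mon n \<tau>\<close> forces
  \<open>\<tau> i = \<sigma> i\<close> in every row.\<close>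

lemma lookup_detX_power:
  assumes "\<sigma> permutes {0..<n}"
  shows "Poly_Mapping.lookup (detX n ^ k) (Poly_Mapping.map (\<lambda>e. k * e) (mon n \<sigma>)) = sign \<sigma> ^ k"
proof (induction k)
  case 0
  have "Poly_Mapping.map (\<lambda>e. 0 * e) (mon n \<sigma>) = 0" by (simp add: Poly_Mapping.map_eq_zero_iff)
  then show ?case by simp
next
  case (Suc k)
  let ?m = "\<lambda>k. Poly_Mapping.map (\<lambda>e. k * e) (mon n \<sigma>)"
  have step: "Poly_Mapping.lookup (detX n ^ k * Poly_Mapping.single (mon n \<tau>) c) (?m (Suc k))
      = (if \<tau> = \<sigma> then c * sign \<sigma> ^ k else 0)" if "\<tau> permutes {0..<n}" for \<tau> c
  proof -
    have eq: "m + mon n \<tau> = ?m (Suc k) \<longleftrightarrow> \<tau> = \<sigma> \<and> m = ?m k" for m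
    proof
      assume *: "m + mon n \<tau> = ?m (Suc k)"
      have "\<tau> i = \<sigma> i" for i
      proof (cases "i < n")
        case True
        have "Poly_Mapping.lookup (m + mon n \<tau>) (i, \<tau> i) = Poly_Mapping.lookup (?m (Suc k)) (i, \<tau> i)"
          using * by simp
        then show ?thesis using True by (auto simp: lookup_add lookup_mon simp del: mult_Suc split: if_splits)
      next
        case False
        then show ?thesis using that assms by (simp add: permutes_def)
      qed
      then have "\<tau> = \<sigma>" by auto
      moreover have "?m k + mon n \<sigma> = ?m (Suc k)" by (rule poly_mapping_eqI) (simp add: lookup_add del: mult_Suc, simp)
      ultimately show "\<tau> = \<sigma> \<and> m = ?m k" using * by (metis add_right_imp_eq)
    next
      assume "\<tau> = \<sigma> \<and> m = ?m k"
      then show "m + mon n \<tau> = ?m (Suc k)" 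
        by (intro poly_mapping_eqI) (simp add: lookup_add del: mult_Suc, simp)
    qed
    show ?thesis unfolding lookup_mult_single eq
      using Suc by (auto simp: in_keys_iff)
  qed
  have "detX n ^ Suc k = (\<Sum>\<tau> | \<tau> permutes {0..<n}. detX n ^ k * Poly_Mapping.single (mon n \<tau>) (sign \<tau>))"
    unfolding power_Suc2 by (subst (2) detX_eq_sum_single) (simp add: sum_distrib_left)
  then show ?case using assms
    by (simp add: lookup_sum step finite_permutations del: power_Suc mult_Suc) simp
qed

section \<open>The weight of a corner monomial and its recursion\<close>

text \<open>Integer arguments, with value zero when one of them is negative, make Pascal's rule hold for all lower indices.\<close>

definition ibin :: "int \<Rightarrow> int \<Rightarrow> int" where
  "ibin a k = (if a < 0 \<or> k < 0 then 0 else int (nat a choose nat k))"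

lemma ibin_pascal:
  assumes "a \<ge> 0"
  shows "ibin (a + 1) k = ibin a (k - 1) + ibin a k"
proof (cases "k \<le> 0")
  case True
  then show ?thesis using assms by (cases "k = 0") (auto simp: ibin_def)
next
  case False
  then obtain j where j: "k = int (Suc j)" by (metis not_le zero_less_imp_eq_int Suc_pred)
  from assms obtain b where b: "a = int b" using nonneg_eq_int by blast
  have "nat (1 + int b) = Suc b" "nat (1 + int j) = Suc j" "nat (int b + 1) = Suc b" by auto
  then show ?thesis by (simp add: ibin_def j b)
qed

lemma ibin_nonzero: "ibin a k \<noteq> 0 \<Longrightarrow> 0 \<le> k \<and> k \<le> a"
  by (auto simp: ibin_def split: if_splits)

lemma ibin_zero_left: "ibin 0 k = (if k = 0 then 1 else 0)"
  by (auto simp: ibin_def)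

text \<open>
  The closed form of \<open>\<psi>\<close> in the exponents of the eight variables of the header: for \<open>t \<noteq> 0\<close> the two
  factors are coefficients of \<open>K ^ (t - 1)\<close> and \<open>L ^ (p - t)\<close> up to sign, and \<open>t = 0\<close> is the correction term.
\<close>

definition wt :: "int \<Rightarrow> int \<Rightarrow> int \<Rightarrow> int \<Rightarrow> int \<Rightarrow> int \<Rightarrow> int \<Rightarrow> int \<Rightarrow> int \<Rightarrow> int \<Rightarrow> int" where
  "wt p M u a b v c e s t =
     (if u + v = p \<and> s + t = p \<and> u + a + b = 2 * M + p \<and> v + c + e = 2 * M + p \<and> a + c + s = 2 * M + p
      then (- 1) ^ nat (a + b) *
           (if t = 0 then (if u = 0 \<and> e = M + p - 1 then 1 else 0)
            else ibin (t - 1) (M + p - 1 - e) * ibin s (M + 1 - c))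
      else 0)"

text \<open>For \<open>t \<noteq> 0\<close> the binomials bound \<open>c\<close> and
  \<open>e\<close> on both sides, and the degree equations turn the lower bounds into upper bounds
  for \<open>a\<close> and \<open>b\<close>. For \<open>t = 0\<close> all exponents are determined
  by \<open>p\<close> and \<open>M\<close>.\<close>

lemma wt_bound:
  assumes "wt p M u a b v c e s t \<noteq> 0" "2 \<le> p" "0 \<le> u" "0 \<le> s" "0 \<le> t"
  shows "a < M + p \<and> b < M + p \<and> c < M + p \<and> e < M + p"
proof (cases "t = 0")
  case True
  then show ?thesis using assms by (auto simp: wt_def split: if_splits)
next
  case False
  then have "ibin (t - 1) (M + p - 1 - e) \<noteq> 0" "ibin s (M + 1 - c) \<noteq> 0"
    using assms by (auto simp: wt_def split: if_splits)
  then have "0 \<le> M + p - 1 - e" "M + p - 1 - e \<le> t - 1" "0 \<le> M + 1 - c" "M + 1 - c \<le> s"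
    using ibin_nonzero by blast+
  then show ?thesis using assms by (auto simp: wt_def split: if_splits)
qed

text \<open>The end term \<open>L ^ p G\<^sub>0\<close> of the telescoping sum minus the correction.
  Up to sign, \<open>ibin p (v + 1)\<close> is the coefficient of \<open>(u c) ^ (v + 1)\<close> in
  \<open>L ^ p\<close>; the case \<open>u = 0\<close> is the summand
  \<open>(u c) ^ p\<close>.\<close>

definition defect :: "int \<Rightarrow> int \<Rightarrow> int \<Rightarrow> int \<Rightarrow> int \<Rightarrow> int \<Rightarrow> int \<Rightarrow> int \<Rightarrow> int \<Rightarrow> int \<Rightarrow> int" where
  "defect p M u a b v c e s t =
     (if t = 0 \<and> s = p - 1 \<and> u + v = p - 1 \<and> a + c = 2 * M \<and> b = M \<and> e = M + p - 1 \<and> v + c = M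
      then (- 1) ^ nat (a + b) * (ibin p (v + 1) - (if u = 0 then 1 else 0)) else 0)"

text \<open>The summands are the terms of \<open>t L - s K = t u c - s u e - t v a + s v b\<close>.
  For \<open>t > 0\<close> they cancel by Pascal's rule for both binomials; at \<open>t = 0\<close>
  the \<open>L\<close>-binomial and the correction survive.\<close>

lemma wt_det:
  assumes "0 \<le> u" "0 \<le> v" "0 \<le> a" "0 \<le> b" "0 \<le> s" "0 \<le> t"
  shows "wt p M (u + 1) a b v (c + 1) e s (t + 1) - wt p M (u + 1) a b v c (e + 1) (s + 1) t
       - wt p M u (a + 1) b (v + 1) c e s (t + 1) + wt p M u a (b + 1) (v + 1) c e (s + 1) t
       = defect p M u a b v c e s t"
proof (cases "u + v + 1 = p \<and> s + t + 1 = p \<and> u + a + b + 1 = 2 * M + p \<and> v + c + e + 1 = 2 * M + p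
              \<and> a + c + s + 1 = 2 * M + p")
  case False
  then have "wt p M (u + 1) a b v (c + 1) e s (t + 1) = 0" "wt p M (u + 1) a b v c (e + 1) (s + 1) t = 0"
      "wt p M u (a + 1) b (v + 1) c e s (t + 1) = 0" "wt p M u a (b + 1) (v + 1) c e (s + 1) t = 0"
    unfolding wt_def by (auto simp: algebra_simps)
  moreover have "defect p M u a b v c e s t = 0" using False unfolding defect_def by auto
  ultimately show ?thesis by simp
next
  case True
  define \<epsilon> :: int where "\<epsilon> = (- 1) ^ nat (a + b)"
  \<comment> \<open>The lower indices of the two binomials: raising \<open>e\<close> or
    \<open>c\<close> by one lowers \<open>k\<close> or \<open>l\<close> by one.\<close>
  define k l where "k = M + p - 1 - e" and "l = M + 1 - c"
  have sgn: "(- 1) ^ nat (a + 1 + b) = - \<epsilon>" "(- 1) ^ nat (a + (b + 1)) = - \<epsilon>"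
    using assms by (simp_all add: \<epsilon>_def nat_add_distrib)
  have t_terms: "wt p M (u + 1) a b v (c + 1) e s (t + 1) = \<epsilon> * (ibin t k * ibin s (l - 1))"
    "wt p M u (a + 1) b (v + 1) c e s (t + 1) = - \<epsilon> * (ibin t k * ibin s l)"
    using True assms sgn by (auto simp: wt_def \<epsilon>_def k_def l_def algebra_simps)
  show ?thesis
  proof (cases "t = 0")
    case t0: True
    have "wt p M (u + 1) a b v c (e + 1) (s + 1) t = 0"
      using assms t0 by (simp add: wt_def)
    moreover have "wt p M u a (b + 1) (v + 1) c e (s + 1) t = - \<epsilon> * (if u = 0 \<and> k = 0 then 1 else 0)"
      using True sgn t0 by (auto simp: wt_def k_def algebra_simps)
    moreover have "defect p M u a b v c e s t = (if k = 0 then \<epsilon> * (ibin p l - (if u = 0 then 1 else 0)) else 0)"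
    proof (cases "k = 0")
      case True
      then have "e = M + p - 1" "b = M" "v + c = M" "v + 1 = l" "a + c = 2 * M" "s = p - 1" "u + v = p - 1"
        using \<open>u + v + 1 = p \<and> _\<close> t0 by (auto simp: k_def l_def)
      then show ?thesis using t0 True by (simp add: defect_def \<epsilon>_def)
    next
      case False
      then show ?thesis by (auto simp: defect_def k_def)
    qed
    moreover have "s + 1 = p" using True t0 by simp
    moreover have "\<epsilon> * ibin s (l - 1) + \<epsilon> * ibin s l = \<epsilon> * ibin (s + 1) l"
      by (simp add: ibin_pascal[OF assms(5)] distrib_left)
    ultimately show ?thesis using t_terms t0
      by (auto simp: ibin_zero_left algebra_simps)
  next
    case t1: False
    have s_terms: "wt p M (u + 1) a b v c (e + 1) (s + 1) t = \<epsilon> * (ibin (t - 1) (k - 1) * ibin (s + 1) l)"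
      "wt p M u a (b + 1) (v + 1) c e (s + 1) t = - \<epsilon> * (ibin (t - 1) k * ibin (s + 1) l)"
      using True sgn t1 by (auto simp: wt_def \<epsilon>_def k_def l_def algebra_simps)
    have "ibin t k = ibin (t - 1) (k - 1) + ibin (t - 1) k"
      using ibin_pascal[of "t - 1" k] assms(6) t1 by simp
    moreover have "defect p M u a b v c e s t = 0" using t1 by (simp add: defect_def)
    ultimately show ?thesis
      unfolding t_terms s_terms ibin_pascal[OF assms(5)] by (simp add: algebra_simps)
  qed
qed

text \<open>For \<open>u = 0\<close> the binomial is \<open>p choose p\<close>, which the correction
  cancels; otherwise \<open>0 < v + 1 < p\<close>.\<close>

lemma prime_dvd_defect:
  assumes "prime p" "0 \<le> u" "0 \<le> v"
  shows "int p dvd defect (int p) M u a b v c e s t"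
proof -
  have "int p dvd ibin (int p) (v + 1) - (if u = 0 then 1 else 0)" if "u + v = int p - 1"
  proof (cases "u = 0")
    case True
    then show ?thesis using that by (simp add: ibin_def)
  next
    case False
    then have "nat (v + 1) < p" "nat (v + 1) \<noteq> 0" "p \<noteq> 0" using that assms by auto
    then have "p dvd (p choose nat (v + 1))" using assms(1) by (intro dvd_choose_prime)
    then have "int p dvd int (p choose nat (v + 1))" by simp
    then show ?thesis using False assms by (simp add: ibin_def)
  qed
  then show ?thesis by (simp add: defect_def)
qed


section \<open>The functional on monomials and its behaviour under the determinant\<close>

text \<open>The exponents prescribed off the eight variables: \<open>M\<close> on the other generators, \<open>q\<close> on the
  diagonal below the corner, and zero elsewhere.\<close>

definition frame :: "nat \<Rightarrow> nat \<Rightarrow> nat \<Rightarrow> mono \<Rightarrow> bool" where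
  "frame n M q m \<longleftrightarrow> (\<forall>i j. (i, j) \<notin> {..<3} \<times> {..<3} - {(2, 0)} \<longrightarrow>
     Poly_Mapping.lookup m (i, j) =
       (if i < 2 \<and> 3 \<le> j \<and> j < n then M else if 3 \<le> i \<and> i = j \<and> j < n then q else 0))"

text \<open>Entry \<open>(2, 0)\<close> is absent because \<open>frame\<close> forces its exponent
  to be zero.\<close>

abbreviation core :: "(int \<Rightarrow> int \<Rightarrow> int \<Rightarrow> int \<Rightarrow> int \<Rightarrow> int \<Rightarrow> int \<Rightarrow> int \<Rightarrow> int) \<Rightarrow> mono \<Rightarrow> int" where
  "core w m \<equiv> (let x = (\<lambda>i j. int (Poly_Mapping.lookup m (i, j))) in
     w (x 0 0) (x 0 1) (x 0 2) (x 1 0) (x 1 1) (x 1 2) (x 2 1) (x 2 2))"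

definition psi :: "nat \<Rightarrow> nat \<Rightarrow> nat \<Rightarrow> mono \<Rightarrow> int" where
  "psi n p M m = (if frame n M p m then core (wt (int p) (int M)) m else 0)"

text \<open>This will be \<open>psi\<close> composed with multiplication by \<open>detX n\<close>,
  which uses up one diagonal factor; hence \<open>p - 1\<close>.\<close>

definition kappa :: "nat \<Rightarrow> nat \<Rightarrow> nat \<Rightarrow> mono \<Rightarrow> int" where
  "kappa n p M m = (if frame n M (p - 1) m then core (defect (int p) (int M)) m else 0)"

text \<open>Outside the corner the frame prescribes exponent \<open>M\<close> on the generators;
  inside it \<open>wt_bound\<close> applies.\<close>

lemma psi_eq_zero:
  assumes "g \<in> gens n" "M + p \<le> Poly_Mapping.lookup m g" "2 \<le> p"
  shows "psi n p M m = 0"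
proof (rule ccontr)
  assume nz: "psi n p M m \<noteq> 0"
  obtain i j where g: "g = (i, j)" "i < 2" "1 \<le> j" "j < n" using assms(1) by (auto simp: gens_def)
  have fr: "frame n M p m" using nz by (simp add: psi_def split: if_splits)
  show False
  proof (cases "3 \<le> j")
    case True
    then have "Poly_Mapping.lookup m (i, j) = M" using fr g by (auto simp: frame_def)
    then show False using assms g by simp
  next
    case False
    have "i = 0 \<or> i = 1" "j = 1 \<or> j = 2" using g False by auto
    moreover have "core (wt (int p) (int M)) m \<noteq> 0" using nz fr by (simp add: psi_def)
    then have "int (Poly_Mapping.lookup m (0, 1)) < int M + int p \<and> int (Poly_Mapping.lookup m (0, 2)) < int M + int p
       \<and> int (Poly_Mapping.lookup m (1, 1)) < int M + int p \<and> int (Poly_Mapping.lookup m (1, 2)) < int M + int p"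
      unfolding Let_def by (rule wt_bound) (use assms in auto)
    ultimately show False using assms(2) g(1) by auto
  qed
qed

text \<open>Such a permutation preserves \<open>{0, 1, 2}\<close>; the four survivors are the terms
  of \<open>t L - s K\<close>.\<close>

lemma permutes_corner_cases:
  fixes \<sigma> :: "nat \<Rightarrow> nat"
  assumes "\<sigma> permutes {0..<n}" and fix3: "\<And>i. 3 \<le> i \<Longrightarrow> \<sigma> i = i" and "\<sigma> 2 = 1 \<or> \<sigma> 2 = 2"
  shows "\<sigma> \<in> {id, transpose 1 2, transpose 0 1, transpose 1 2 \<circ> transpose 0 1}"
proof -
  have inj: "\<sigma> i = \<sigma> j \<longleftrightarrow> i = j" for i j
    using permutes_inj[OF assms(1)] by (auto simp: inj_def)
  have lt: "\<sigma> i < 3" if "i < 3" for i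
  proof (rule ccontr)
    assume "\<not> \<sigma> i < 3"
    then have "\<sigma> (\<sigma> i) = \<sigma> i" using fix3 by simp
    then show False using inj that \<open>\<not> \<sigma> i < 3\<close> by metis
  qed
  have 3: "i = 0 \<or> i = 1 \<or> i = 2 \<or> 3 \<le> i" for i :: nat by auto
  have eq: "\<sigma> = \<tau>" if "\<sigma> 0 = \<tau> 0" "\<sigma> 1 = \<tau> 1" "\<sigma> 2 = \<tau> 2" "\<And>i. 3 \<le> i \<Longrightarrow> \<tau> i = i" for \<tau>
    using that fix3 3 by (metis ext)
  have "\<sigma> 0 \<noteq> \<sigma> 1" "\<sigma> 0 \<noteq> \<sigma> 2" "\<sigma> 1 \<noteq> \<sigma> 2" "\<sigma> 0 < 3" "\<sigma> 1 < 3" using inj lt by auto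
  with assms(3) have "\<sigma> 0 = 0 \<and> \<sigma> 1 = 1 \<and> \<sigma> 2 = 2 \<or> \<sigma> 0 = 0 \<and> \<sigma> 1 = 2 \<and> \<sigma> 2 = 1
     \<or> \<sigma> 0 = 1 \<and> \<sigma> 1 = 0 \<and> \<sigma> 2 = 2 \<or> \<sigma> 0 = 2 \<and> \<sigma> 1 = 0 \<and> \<sigma> 2 = 1"
    by linarith
  then show ?thesis
  proof (elim disjE)
    assume "\<sigma> 0 = 0 \<and> \<sigma> 1 = 1 \<and> \<sigma> 2 = 2"
    then have "\<sigma> = id" by (intro eq) auto
    then show ?thesis by simp
  next
    assume "\<sigma> 0 = 0 \<and> \<sigma> 1 = 2 \<and> \<sigma> 2 = 1"
    then have "\<sigma> = transpose 1 2" by (intro eq) (auto simp: transpose_def)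
    then show ?thesis by simp
  next
    assume "\<sigma> 0 = 1 \<and> \<sigma> 1 = 0 \<and> \<sigma> 2 = 2"
    then have "\<sigma> = transpose 0 1" by (intro eq) (auto simp: transpose_def)
    then show ?thesis by simp
  next
    assume "\<sigma> 0 = 2 \<and> \<sigma> 1 = 0 \<and> \<sigma> 2 = 1"
    then have "\<sigma> = transpose 1 2 \<circ> transpose 0 1" by (intro eq) (auto simp: transpose_def)
    then show ?thesis by simp
  qed
qed

lemma lookup_mon_off_corner:
  assumes "3 \<le> n" "\<sigma> 0 < 3" "\<sigma> 1 < 3" "\<sigma> 2 \<in> {1, 2}" "\<And>i. 3 \<le> i \<Longrightarrow> \<sigma> i = i"
    and "(i, j) \<notin> {..<3} \<times> {..<3} - {(2, 0)}"
  shows "Poly_Mapping.lookup (mon n \<sigma>) (i, j) = (if 3 \<le> i \<and> i = j \<and> j < n then 1 else 0)"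
  using assms by (cases "i = 0 \<or> i = 1 \<or> i = 2") (auto simp: lookup_mon)

text \<open>The zero exponents in the frame discard all permutations but the four of the corner, for
  which \<open>wt_det\<close> gives the sum.\<close>

lemma psi_det:
  assumes "3 \<le> n" "2 \<le> p"
  shows "(\<Sum>\<sigma> | \<sigma> permutes {0..<n}. sign \<sigma> * psi n p M (m + mon n \<sigma>)) = kappa n p M m"
proof -
  let ?S = "{id, transpose 1 2, transpose 0 1, transpose 1 2 \<circ> transpose 0 1} :: (nat \<Rightarrow> nat) set"
  have "?S \<subseteq> {\<sigma>. \<sigma> permutes {0..<n}}"
    using assms(1) by (auto intro!: permutes_id permutes_swap_id permutes_compose)
  moreover have "psi n p M (m + mon n \<sigma>) = 0" if "\<sigma> permutes {0..<n}" "\<sigma> \<notin> ?S" for \<sigma>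
  proof (rule ccontr)
    assume "psi n p M (m + mon n \<sigma>) \<noteq> 0"
    then have fr: "frame n M p (m + mon n \<sigma>)" by (simp add: psi_def split: if_splits)
    have "\<sigma> i = i" if "3 \<le> i" for i
    proof (cases "i < n")
      case True
      show ?thesis
      proof (rule ccontr)
        assume "\<sigma> i \<noteq> i"
        then have "Poly_Mapping.lookup (m + mon n \<sigma>) (i, \<sigma> i) = 0" using fr that by (auto simp: frame_def)
        then show False using True by (simp add: lookup_add lookup_mon)
      qed
    next
      case False
      then show ?thesis using \<open>\<sigma> permutes {0..<n}\<close> by (simp add: permutes_def)
    qed
    moreover have "\<sigma> 2 = 1 \<or> \<sigma> 2 = 2"
    proof (rule ccontr)
      assume "\<not> (\<sigma> 2 = 1 \<or> \<sigma> 2 = 2)"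
      then have "(2, \<sigma> 2) \<notin> {..<3} \<times> {..<3} - {(2::nat, 0::nat)}" by auto
      then have "Poly_Mapping.lookup (m + mon n \<sigma>) (2, \<sigma> 2) = 0" using fr by (auto simp: frame_def)
      then show False using assms(1) by (simp add: lookup_add lookup_mon)
    qed
    ultimately show False using permutes_corner_cases that by blast
  qed
  ultimately have "(\<Sum>\<sigma> | \<sigma> permutes {0..<n}. sign \<sigma> * psi n p M (m + mon n \<sigma>)) =
      (\<Sum>\<sigma>\<in>?S. sign \<sigma> * psi n p M (m + mon n \<sigma>))"
    by (intro sum.mono_neutral_right) (auto simp: finite_permutations)
  also have "\<dots> = psi n p M (m + mon n id) - psi n p M (m + mon n (transpose 1 2))
      - psi n p M (m + mon n (transpose 0 1)) + psi n p M (m + mon n (transpose 1 2 \<circ> transpose 0 1))"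
  proof -
    have ne: "id \<noteq> transpose 1 (2::nat)" "id \<noteq> transpose 0 (1::nat)" "id \<noteq> transpose 1 2 \<circ> transpose 0 (1::nat)"
      "transpose 1 (2::nat) \<noteq> transpose 0 1" "transpose 1 (2::nat) \<noteq> transpose 1 2 \<circ> transpose 0 1"
      "transpose 0 (1::nat) \<noteq> transpose 1 2 \<circ> transpose 0 1"
      by (auto simp: fun_eq_iff transpose_def intro: exI[of _ 0] exI[of _ 1] exI[of _ 2])
    show ?thesis using ne
      by (simp add: sign_compose sign_swap_id permutation_swap_id)
  qed
  also have "\<dots> = kappa n p M m"
  proof -
    \<comment> \<open>Outside the corner, each of the four monomials consists of the diagonal
      variables to the first power.\<close>
    have fr: "frame n M p (m + mon n \<sigma>) \<longleftrightarrow> frame n M (p - 1) m" if "\<sigma> \<in> ?S" for \<sigma>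
    proof -
      have "\<sigma> 0 < 3" "\<sigma> 1 < 3" "\<sigma> 2 \<in> {1, 2}" "\<And>i. 3 \<le> i \<Longrightarrow> \<sigma> i = i"
        using that by (auto simp: transpose_def)
      note lookup_mon_off_corner[OF assms(1) this]
      then have "Poly_Mapping.lookup (m + mon n \<sigma>) (i, j) =
           (if i < 2 \<and> 3 \<le> j \<and> j < n then M else if 3 \<le> i \<and> i = j \<and> j < n then p else 0)
         \<longleftrightarrow> Poly_Mapping.lookup m (i, j) =
           (if i < 2 \<and> 3 \<le> j \<and> j < n then M else if 3 \<le> i \<and> i = j \<and> j < n then p - 1 else 0)"
        if "(i, j) \<notin> {..<3} \<times> {..<3} - {(2, 0)}" for i j
        using that assms by (auto simp: lookup_add)
      then show ?thesis unfolding frame_def by blast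
    qed
    show ?thesis
    proof (cases "frame n M (p - 1) m")
      case False
      then show ?thesis using fr by (simp add: psi_def kappa_def)
    next
      case True
      have n: "0 < n" "Suc 0 < n" "2 < n" using assms by auto
      show ?thesis using True fr n
          wt_det[of "int (Poly_Mapping.lookup m (0, 0))" "int (Poly_Mapping.lookup m (1, 0))"
            "int (Poly_Mapping.lookup m (0, 1))" "int (Poly_Mapping.lookup m (0, 2))"
            "int (Poly_Mapping.lookup m (2, 1))" "int (Poly_Mapping.lookup m (2, 2))" "int p" "int M"
            "int (Poly_Mapping.lookup m (1, 1))" "int (Poly_Mapping.lookup m (1, 2))"]
        by (simp add: psi_def kappa_def Let_def lookup_add lookup_mon transpose_def add.commute)
    qed
  qed
  finally show ?thesis .
qed

section \<open>Evaluation of the functional on the class\<close>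

lemma finite_gens [simp]: "finite (gens n)"
  by (rule finite_subset[of _ "{..<2} \<times> {..<n}"]) (auto simp: gens_def)

lemma gvar_power: "gvar g ^ k = Poly_Mapping.single (Poly_Mapping.single g k) 1"
  by (simp add: gvar_def var_def single_power)

definition gexp :: "nat \<Rightarrow> nat \<Rightarrow> mono" where
  "gexp n M = Poly_Mapping.map (\<lambda>e. M * e) (\<Sum>g\<in>gens n. Poly_Mapping.single g 1)"

lemma lookup_gexp: "Poly_Mapping.lookup (gexp n M) g = (if g \<in> gens n then M else 0)"
  by (simp add: gexp_def lookup_sum lookup_single when_def)

lemma prod_gvar_power: "(\<Prod>g\<in>gens n. gvar g) ^ M = Poly_Mapping.single (gexp n M) 1"
  by (simp add: gvar_power[of _ 1, simplified] prod_single_1 single_power gexp_def)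

lemma lin_psi_mult_gvar_power:
  assumes "g \<in> gens n" "M + p \<le> k" "2 \<le> p"
  shows "lin (psi n p M) (F * gvar g ^ k) = 0"
  unfolding gvar_power lin_mult_single
  by (simp add: lin_eq_zero psi_eq_zero[OF assms(1) _ assms(3)] lookup_add assms(2) trans_le_add2)

lemma lin_psi_mult_detX:
  assumes "3 \<le> n" "2 \<le> p"
  shows "lin (psi n p M) (F * detX n) = lin (kappa n p M) F"
proof -
  have "lin (psi n p M) (F * detX n) =
      (\<Sum>\<sigma> | \<sigma> permutes {0..<n}. sign \<sigma> * lin (\<lambda>m. psi n p M (m + mon n \<sigma>)) F)"
    by (simp add: detX_eq_sum_single sum_distrib_left lin_sum lin_mult_single)
  also have "\<dots> = lin (\<lambda>m. \<Sum>\<sigma> | \<sigma> permutes {0..<n}. sign \<sigma> * psi n p M (m + mon n \<sigma>)) F"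
    unfolding lin_def sum_distrib_left by (subst sum.swap) (simp add: mult.left_commute)
  finally show ?thesis by (simp add: psi_det[OF assms])
qed

lemma prime_dvd_kappa:
  assumes "prime p"
  shows "int p dvd kappa n p M m"
  by (simp add: kappa_def Let_def prime_dvd_defect[OF assms])

text \<open>Since \<open>gexp\<close> already contributes \<open>M\<close> to each generator,
  \<open>b = M\<close>, \<open>a + c = 2 M\<close> and \<open>v + c = M\<close> leave no room for
  further factors \<open>b\<close>, \<open>a\<close>, \<open>c\<close>, \<open>v\<close>. What
  remains in the corner is \<open>(u e s) ^ (p - 1)\<close>.\<close>

lemma kappa_concentrated:
  assumes "3 \<le> n" "kappa n p M (x + gexp n M) \<noteq> 0"
  shows "x = Poly_Mapping.map (\<lambda>e. (p - 1) * e) (mon n (transpose 1 2))"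
proof (rule poly_mapping_eqI)
  fix ij :: "nat \<times> nat"
  obtain i j where ij: "ij = (i, j)" by (cases ij)
  have fr: "frame n M (p - 1) (x + gexp n M)"
    and d: "core (defect (int p) (int M)) (x + gexp n M) \<noteq> 0"
    using assms(2) by (auto simp: kappa_def split: if_splits)
  show "Poly_Mapping.lookup x ij = Poly_Mapping.lookup (Poly_Mapping.map (\<lambda>e. (p - 1) * e) (mon n (transpose 1 2))) ij"
  proof (cases "(i, j) \<in> {..<3} \<times> {..<3} - {(2, 0)}")
    case False
    then have "Poly_Mapping.lookup x (i, j) + Poly_Mapping.lookup (gexp n M) (i, j) =
       (if i < 2 \<and> 3 \<le> j \<and> j < n then M else if 3 \<le> i \<and> i = j \<and> j < n then p - 1 else 0)"
      using fr by (simp add: frame_def lookup_add)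
    moreover have "Poly_Mapping.lookup (gexp n M) (i, j) = (if i < 2 \<and> 3 \<le> j \<and> j < n then M else 0)"
      using False by (auto simp: lookup_gexp gens_def)
    ultimately have "Poly_Mapping.lookup x (i, j) = (if 3 \<le> i \<and> i = j \<and> j < n then p - 1 else 0)"
      by (auto split: if_splits)
    moreover have "Poly_Mapping.lookup (mon n (transpose 1 2)) (i, j) = (if 3 \<le> i \<and> i = j \<and> j < n then 1 else 0)"
      by (rule lookup_mon_off_corner[OF assms(1) _ _ _ _ False]) (auto simp: transpose_def)
    ultimately show ?thesis unfolding ij by simp
  next
    case True
    then have "i = 0 \<or> i = 1 \<or> i = 2" "j = 0 \<or> j = 1 \<or> j = 2" by auto
    then have cases: "(i, j) \<in> {(0, 0), (0, 1), (0, 2), (1, 0), (1, 1), (1, 2), (2, 1), (2, 2)}"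
      using True by auto
    have g: "(0, 0) \<notin> gens n" "(0, Suc 0) \<in> gens n" "(0, 2) \<in> gens n" "(Suc 0, 0) \<notin> gens n" "(Suc 0, Suc 0) \<in> gens n"
       "(Suc 0, 2) \<in> gens n" "(2, Suc 0) \<notin> gens n" "(2, 2) \<notin> gens n"
      using assms(1) by (auto simp: gens_def)
    have "Poly_Mapping.lookup x (2, 2) = 0 \<and> Poly_Mapping.lookup x (2, 1) = p - 1 \<and>
        Poly_Mapping.lookup x (0, 0) = p - 1 \<and> Poly_Mapping.lookup x (1, 0) = 0 \<and>
        Poly_Mapping.lookup x (0, 1) = 0 \<and> Poly_Mapping.lookup x (0, 2) = 0 \<and>
        Poly_Mapping.lookup x (1, 1) = 0 \<and> Poly_Mapping.lookup x (1, 2) = p - 1"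
      using d g by (auto simp: Let_def defect_def lookup_add lookup_gexp split: if_splits)
    then show ?thesis using cases assms(1) unfolding ij
      by (auto simp: lookup_mon transpose_def)
  qed
qed

lemma kappa_peak:
  assumes "3 \<le> n" "2 \<le> p"
  shows "kappa n p M (Poly_Mapping.map (\<lambda>e. (p - 1) * e) (mon n (transpose 1 2)) + gexp n M) = int p"
proof -
  let ?m = "Poly_Mapping.map (\<lambda>e. (p - 1) * e) (mon n (transpose 1 2)) + gexp n M"
  have "frame n M (p - 1) ?m"
    unfolding frame_def
    by (auto simp: lookup_add lookup_mon lookup_gexp gens_def transpose_def split: if_splits)
  \<comment> \<open>Here \<open>a = b = M\<close>, so the sign is positive; \<open>v = 0\<close> and
    \<open>u = p - 1 \<noteq> 0\<close> give \<open>ibin p 1 = p\<close> without correction.\<close>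
  moreover have "(- 1) ^ nat (2 * int M) = (1::int)" by (simp add: nat_mult_distrib)
  then have "core (defect (int p) (int M)) ?m = int p"
    using assms
    by (simp add: Let_def lookup_add lookup_mon lookup_gexp gens_def transpose_def defect_def ibin_def of_nat_diff
        nat_add_distrib flip: mult_2 power_add)
  ultimately show ?thesis by (simp add: kappa_def)
qed

text \<open>The first two rows select different columns, so one of them avoids column 0.\<close>

lemma single_mon_eq_mult_gvar:
  assumes "3 \<le> n" "\<sigma> permutes {0..<n}"
  obtains g m where "g \<in> gens n" "Poly_Mapping.single (mon n \<sigma>) (1::int) = Poly_Mapping.single m 1 * gvar g"
proof -
  have "\<sigma> 0 \<noteq> \<sigma> 1" using permutes_inj[OF assms(2)] by (auto simp: inj_def)
  moreover define i where "i = (if \<sigma> 0 = 0 then 1 else 0::nat)"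
  ultimately have i: "i < 2" "\<sigma> i \<noteq> 0" by auto
  moreover have "\<sigma> i < n" using permutes_in_image[OF assms(2), of i] i assms(1) by simp
  ultimately have g: "(i, \<sigma> i) \<in> gens n" by (simp add: gens_def)
  have "mon n \<sigma> = Poly_Mapping.single (i, \<sigma> i) 1 + (\<Sum>k\<in>{..<n} - {i}. Poly_Mapping.single (k, \<sigma> k) 1)"
    unfolding mon_def using i assms(1) by (intro sum.remove) auto
  then have "Poly_Mapping.single (mon n \<sigma>) (1::int) =
     Poly_Mapping.single (\<Sum>k\<in>{..<n} - {i}. Poly_Mapping.single (k, \<sigma> k) 1) 1 * gvar (i, \<sigma> i)"
    using gvar_power[of "(i, \<sigma> i)" 1] by (simp add: mult_single add.commute)
  with g show thesis by (rule that)
qed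

lemma lin_psi_pder:
  assumes "3 \<le> n" "prime p"
  shows "lin (psi n p M) ((\<Prod>g\<in>gens n. gvar g) ^ M * pder p (detX n)) = - ((- 1) ^ (p - 1))"
proof -
  have p: "2 \<le> p" using assms(2) prime_ge_2_nat by blast
  let ?f = "\<Prod>g\<in>gens n. gvar g" and ?\<sigma> = "transpose 1 (2::nat)"
  have perm: "?\<sigma> permutes {0..<n}" using assms(1) by (intro permutes_swap_id) auto
  have "lin (psi n p M) (?f ^ M * (const (sign \<sigma>) * Poly_Mapping.single (mon n \<sigma>) 1 ^ p)) = 0"
    if perm: "\<sigma> permutes {0..<n}" for \<sigma>
  proof -
    obtain g m where g: "g \<in> gens n" "Poly_Mapping.single (mon n \<sigma>) (1::int) = Poly_Mapping.single m 1 * gvar g"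
      using single_mon_eq_mult_gvar[OF assms(1) perm] .
    have "?f ^ M = (\<Prod>h\<in>gens n - {g}. gvar h) ^ M * gvar g ^ M"
      by (simp add: prod.remove[OF finite_gens g(1)] power_mult_distrib mult.commute)
    then have "?f ^ M * (const (sign \<sigma>) * Poly_Mapping.single (mon n \<sigma>) 1 ^ p) =
       ((\<Prod>h\<in>gens n - {g}. gvar h) ^ M * const (sign \<sigma>) * Poly_Mapping.single m 1 ^ p) * gvar g ^ (M + p)"
      unfolding g(2) by (simp only: power_mult_distrib power_add mult_ac)
    then show ?thesis using lin_psi_mult_gvar_power[OF g(1) order_refl p] by simp
  qed
  then have "lin (psi n p M) (?f ^ M * Lambda p (detX n)) = 0"
    unfolding Lambda_detX sum_distrib_left lin_sum by (intro sum.neutral) blast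
  moreover have "lin (psi n p M) (?f ^ M * detX n ^ p) = int p * (- 1) ^ (p - 1)"
  proof -
    \<comment> \<open>One factor \<open>detX n\<close> is traded for \<open>kappa\<close>, which
      then probes the remaining power at a single monomial.\<close>
    have "?f ^ M * detX n ^ p = detX n ^ (p - 1) * Poly_Mapping.single (gexp n M) 1 * detX n"
      unfolding prod_gvar_power mult.assoc using power_minus_mult[of p "detX n"] p
      by (simp add: mult.left_commute mult.commute[of _ "detX n ^ _"])
    then have "lin (psi n p M) (?f ^ M * detX n ^ p) = lin (\<lambda>x. kappa n p M (x + gexp n M)) (detX n ^ (p - 1))"
      by (simp only: lin_psi_mult_detX[OF assms(1) p] lin_mult_single mult_1)
    also have "\<dots> = (- 1) ^ (p - 1) * int p"
      using kappa_concentrated[OF assms(1)]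
      by (subst lin_concentrated[of "Poly_Mapping.map (\<lambda>e. (p - 1) * e) (mon n ?\<sigma>)"])
         (auto simp: kappa_peak[OF assms(1) p, simplified] lookup_detX_power[OF perm, simplified] sign_swap_id)
    finally show ?thesis by simp
  qed
  moreover have "int p * lin (psi n p M) (?f ^ M * pder p (detX n)) =
      lin (psi n p M) (?f ^ M * Lambda p (detX n)) - lin (psi n p M) (?f ^ M * detX n ^ p)"
  proof -
    have "(?f ^ M * pder p (detX n)) * Poly_Mapping.single 0 (int p) =
        ?f ^ M * Lambda p (detX n) - ?f ^ M * detX n ^ p"
      unfolding right_diff_distrib[symmetric] const_mult_pder_detX[OF assms(2), symmetric] const_def
      by (simp only: mult_ac)
    from arg_cong[OF this, of "lin (psi n p M)"] show ?thesis
      unfolding lin_mult_single lin_diff by simp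
  qed
  ultimately have "int p * lin (psi n p M) (?f ^ M * pder p (detX n)) = int p * (- ((- 1) ^ (p - 1)))"
    by simp
  \<comment> \<open>The factor \<open>p\<close> is cancelled in the integers; modulo
    \<open>p\<close> the equation would be void.\<close>
  then show ?thesis using p by (simp only: mult_cancel_left) auto
qed

section \<open>Nonvanishing and torsion of the class\<close>

lemma class_nonzero_mod_p:
  assumes "3 \<le> n" "prime p"
  shows "\<not> cech_top_class_zero (zero_in_R_mod n p) (gens n) gvar (pder p (detX n)) p"
proof
  let ?f = "\<Prod>g\<in>gens n. gvar g"
  have p: "2 \<le> p" using assms(2) prime_ge_2_nat by blast
  assume "cech_top_class_zero (zero_in_R_mod n p) (gens n) gvar (pder p (detX n)) p"
  then obtain m N s b c where eq:
    "?f ^ N * (pder p (detX n) * ?f ^ m - ?f ^ p * (\<Sum>g\<in>gens n. s g * gvar g ^ m)) = b * detX n + c * const (int p)"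
    unfolding cech_top_class_zero_def zero_in_R_mod_def by blast
  \<comment> \<open>With this \<open>M\<close>, the summand of \<open>g\<close> in the Cech relation
    contains \<open>gvar g\<close> to the power \<open>(N + p) + m = M + p\<close>, where
    \<open>psi\<close> vanishes.\<close>
  define M where "M = N + m"
  have "?f ^ M * pder p (detX n) = b * detX n + c * const (int p) + (\<Sum>g\<in>gens n. ?f ^ (N + p) * s g * gvar g ^ m)"
  proof -
    have "(\<Sum>g\<in>gens n. ?f ^ (N + p) * s g * gvar g ^ m) = ?f ^ (N + p) * (\<Sum>g\<in>gens n. s g * gvar g ^ m)"
      by (simp add: sum_distrib_left mult.assoc)
    then show ?thesis unfolding eq[symmetric] M_def by (simp add: algebra_simps power_add)
  qed
  then have "lin (psi n p M) (?f ^ M * pder p (detX n)) =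
      lin (kappa n p M) b + lin (psi n p M) (c * const (int p)) + (\<Sum>g\<in>gens n. lin (psi n p M) (?f ^ (N + p) * s g * gvar g ^ m))"
    by (simp only: lin_add lin_sum lin_psi_mult_detX[OF assms(1) p])
  also have "(\<Sum>g\<in>gens n. lin (psi n p M) (?f ^ (N + p) * s g * gvar g ^ m)) = 0"
  proof (rule sum.neutral, rule ballI)
    fix g assume g: "g \<in> gens n"
    have "?f ^ (N + p) * s g * gvar g ^ m = ((\<Prod>h\<in>gens n - {g}. gvar h) ^ (N + p) * s g) * gvar g ^ (M + p)"
      unfolding M_def prod.remove[OF finite_gens g]
      by (simp only: power_mult_distrib power_add mult_ac)
    then show "lin (psi n p M) (?f ^ (N + p) * s g * gvar g ^ m) = 0"
      using lin_psi_mult_gvar_power[OF g order_refl p] by simp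
  qed
  finally have "lin (psi n p M) (?f ^ M * pder p (detX n)) =
      lin (kappa n p M) b + int p * lin (psi n p M) c"
    by (simp only: const_def lin_mult_single) simp
  moreover have "int p dvd lin (kappa n p M) b" by (rule lin_dvd) (rule prime_dvd_kappa[OF assms(2)])
  ultimately have "int p dvd - ((- 1) ^ (p - 1))"
    using lin_psi_pder[OF assms, of M] by simp
  then have "int p dvd 1"
    by (simp add: minus_one_power_iff split: if_splits)
  then show False using p by simp
qed

text \<open>Modulo the determinant, \<open>p\<close> times the numerator is
  \<open>Lambda p (detX n)\<close>, a combination of the \<open>gvar g ^ p\<close>.\<close>

lemma class_p_torsion:
  assumes "3 \<le> n" "prime p"
  shows "cech_top_class_zero (zero_in_R n) (gens n) gvar (const (int p) * pder p (detX n)) p"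
proof -
  have p: "0 < p" using assms(2) prime_gt_0_nat by blast
  let ?f = "\<Prod>g\<in>gens n. gvar g"
  let ?I = "\<lambda>F. \<exists>s. F = (\<Sum>g\<in>gens n. s g * gvar g ^ p)"
  have sum: "?I (\<Sum>i\<in>I. F i)" if "\<And>i. i \<in> I \<Longrightarrow> ?I (F i)" for F and I :: "(nat \<Rightarrow> nat) set"
  proof -
    from that have "\<forall>i\<in>I. ?I (F i)" by blast
    from bchoice[OF this] obtain s where "\<forall>i\<in>I. F i = (\<Sum>g\<in>gens n. s i g * gvar g ^ p)" ..
    then have "(\<Sum>i\<in>I. F i) = (\<Sum>g\<in>gens n. (\<Sum>i\<in>I. s i g) * gvar g ^ p)"
      by (simp add: sum_distrib_right sum.swap[of _ "gens n" I])
    then show ?thesis by (intro exI)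
  qed
  have "?I (Lambda p (detX n))"
    unfolding Lambda_detX
  proof (rule sum)
    fix \<sigma> assume "\<sigma> \<in> {\<sigma>. \<sigma> permutes {0..<n}}"
    then obtain g m where g: "g \<in> gens n" "Poly_Mapping.single (mon n \<sigma>) (1::int) = Poly_Mapping.single m 1 * gvar g"
      using single_mon_eq_mult_gvar[OF assms(1)] by blast
    have "const (sign \<sigma>) * Poly_Mapping.single (mon n \<sigma>) 1 ^ p =
        (\<Sum>h\<in>gens n. (if h = g then const (sign \<sigma>) * Poly_Mapping.single m 1 ^ p else 0) * gvar h ^ p)"
      unfolding g(2) using g(1) by (simp add: if_distrib[of "\<lambda>x. x * _"] power_mult_distrib mult.assoc cong: if_cong)
    then show "?I (const (sign \<sigma>) * Poly_Mapping.single (mon n \<sigma>) 1 ^ p)"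
      by (rule exI[of _ "\<lambda>h. if h = g then const (sign \<sigma>) * Poly_Mapping.single m 1 ^ p else 0"])
  qed
  then obtain s where "Lambda p (detX n) = (\<Sum>g\<in>gens n. s g * gvar g ^ p)" by blast
  \<comment> \<open>The choice \<open>m = p\<close>, \<open>N = 0\<close> matches the denominator
    \<open>f ^ p\<close>: the \<open>Lambda\<close> parts cancel and a multiple of the determinant
    is left.\<close>
  then have "?f ^ 0 * (const (int p) * pder p (detX n) * ?f ^ p - ?f ^ p * (\<Sum>g\<in>gens n. s g * gvar g ^ p))
      = (- (?f ^ p * detX n ^ (p - 1))) * detX n"
    using power_minus_mult[OF p, of "detX n"] unfolding const_mult_pder_detX[OF assms(2)]
    by (simp add: mult.assoc right_diff_distrib mult.commute[of _ "?f ^ p"])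
  then show ?thesis unfolding cech_top_class_zero_def zero_in_R_def
    by (intro exI[of _ p] exI[of _ 0] exI[of _ s] exI)
qed

theorem theorem7p1:
  fixes n p :: nat
  assumes "n \<ge> 3" and "prime p"
  shows "\<not> cech_top_class_zero (zero_in_R n) (gens n) gvar (pder p (detX n)) p
       \<and> cech_top_class_zero (zero_in_R n) (gens n) gvar (const (int p) * pder p (detX n)) p
       \<and> \<not> cech_top_class_zero (zero_in_R_mod n p) (gens n) gvar (pder p (detX n)) p"
proof -
  \<comment> \<open>Vanishing over \<open>R\<close> passes to \<open>R/pR\<close>, so the first
    claim follows from the third.\<close>
  have "zero_in_R_mod n p a" if "zero_in_R n a" for a
    using that unfolding zero_in_R_def zero_in_R_mod_def by (metis add_0_right mult_zero_left)
  then have "cech_top_class_zero (zero_in_R_mod n p) (gens n) gvar r t"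
    if "cech_top_class_zero (zero_in_R n) (gens n) gvar r t" for r t
    using that unfolding cech_top_class_zero_def by blast
  then show ?thesis
    using class_nonzero_mod_p[OF assms] class_p_torsion[OF assms] by blast
qed

end
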